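(* Let $A, B$ be coprime positive integers, and let $\omega_k = \exp(2\pi i k/A)$ and $\varphi_k = 2\pi k / A$ for $k = 0, \dots, A-1$. Let $$L(u) = -\frac{B}{A} \sum_{k=0}^{A-1} \omega_k^B \operatorname{Log}(u - \omega_k),$$ where $\operatorname{Log}$ denotes the principal complex logarithm. Then, for $u \in [0,1)$, the sum $L(u)$ can be reduced to the strictly real representation $$L(u) = -\frac{B}{A} \sum_{k=0}^{A-1} \left[ C_k(u) + S_k(u) \right],$$ where the real functions $C_k$ and $S_k$ are defined by $$C_k(u) = \frac{1}{2} \cos(B\varphi_k) \ln(u^2 + 1 - 2u\cos\varphi_k), \qquad S_k(u) = -\sin(B\varphi_k) \operatorname{atan2}(-\sin\varphi_k,\, u - \cos\varphi_k).$$
   Context: The principal logarithm is $\operatorname{Log} z = \ln|z| + i\arg z$, where $\arg z$ is the principal argument, and $\operatorname{atan2}(b, a)$ denotes the principal argument of the complex number $a + i b \neq 0$. The variable $u$ arises as $u = y^{1/B}$ with $y \in [0,1)$, and $L(u)$ is the logarithmic part of the primitive of $1/(1 - y^{A/B})$.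
   Formalization: The stated identity is false (A = B = 1, u = 0 gives L(0) = −iπ but right side 0), since Log(u − 1) has imaginary part π; the formal version adds the constant −iπB/A to the right-hand side, for all u in [0,1). *)

theory Defs
  imports "HOL-Analysis.Complex_Transcendental"
begin

definition omega :: "nat \<Rightarrow> nat \<Rightarrow> complex" where
  "omega A k = exp (2 * complex_of_real pi * \<i> * of_nat k / of_nat A)"

definition phi :: "nat \<Rightarrow> nat \<Rightarrow> real" where
  "phi A k = 2 * pi * real k / real A"

text \<open>The library's complex \<open>Ln\<close> and \<open>Arg\<close> are the principal branches, with
  \<open>Arg\<close> in \<open>(-pi, pi]\<close>; thus \<open>Ln (u - 1)\<close> has imaginary part \<open>pi\<close> for real \<open>u < 1\<close>.\<close>

definition atan2 :: "real \<Rightarrow> real \<Rightarrow> real" where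
  "atan2 b a = Arg (Complex a b)"

definition L :: "nat \<Rightarrow> nat \<Rightarrow> real \<Rightarrow> complex" where
  "L A B u = - (of_nat B / of_nat A) *
     (\<Sum>k = 0..A - 1. omega A k ^ B * Ln (complex_of_real u - omega A k))"

definition C :: "nat \<Rightarrow> nat \<Rightarrow> nat \<Rightarrow> real \<Rightarrow> real" where
  "C A B k u = 1 / 2 * cos (real B * phi A k) * ln (u\<^sup>2 + 1 - 2 * u * cos (phi A k))"

definition S :: "nat \<Rightarrow> nat \<Rightarrow> nat \<Rightarrow> real \<Rightarrow> real" where
  "S A B k u = - sin (real B * phi A k) * atan2 (- sin (phi A k)) (u - cos (phi A k))"

end

theory Submission
  imports Defs
begin

text \<open>Complex conjugation exchanges the \<open>k\<close>-th and the \<open>(A - k)\<close>-th summand of \<open>L\<close>, because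
  \<open>u - \<omega>\<^sub>k\<close> meets the branch cut of the logarithm only for \<open>k = 0\<close>. So the
  imaginary parts cancel, except for that of \<open>Ln (u - 1)\<close>, which is \<open>pi\<close>.\<close>

lemma omega_cis: "omega A k = cis (phi A k)"
  by (simp add: omega_def phi_def cis_conv_exp mult_ac)

lemma omega_reflect:
  assumes "0 < A" "k \<le> A"
  shows "omega A (A - k) = cnj (omega A k)"
proof -
  have "phi A (A - k) = 2 * pi - phi A k"
    using assms by (simp add: phi_def of_nat_diff field_simps)
  then show ?thesis
    by (simp add: omega_cis complex_eq_iff)
qed

lemma omega_neq_1:
  assumes "0 < k" "k < A"
  shows "omega A k \<noteq> 1"
proof -
  have "omega A k = exp (2 * of_real pi * \<i> * of_nat k / of_nat A)"
    by (simp add: omega_def)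
  moreover have "\<not> A dvd k"
    using assms by (auto dest: dvd_imp_le)
  ultimately show ?thesis
    using complex_root_unity_eq_1[of A k] assms by simp
qed

text \<open>The two numbers have different moduli, \<open>u < 1\<close> against 1, so the logarithm
  is never taken at 0.\<close>

lemma diff_omega_nonzero:
  assumes "u \<in> {0..<1}"
  shows "complex_of_real u - omega A k \<noteq> 0"
proof
  assume "complex_of_real u - omega A k = 0"
  then have "norm (complex_of_real u) = norm (omega A k)" by simp
  then show False using assms by (simp add: omega_cis)
qed

text \<open>On the cut, \<open>omega A k\<close> would be real and at least \<open>u\<close>, hence
  nonnegative; the only such number on the unit circle is 1, the root with index 0.\<close>

lemma diff_omega_off_branch_cut:
  assumes "0 < k" "k < A" "0 \<le> u"
  shows "complex_of_real u - omega A k \<notin> \<real>\<^sub>\<le>\<^sub>0"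
proof
  assume "complex_of_real u - omega A k \<in> \<real>\<^sub>\<le>\<^sub>0"
  then have im: "sin (phi A k) = 0" and re: "u \<le> cos (phi A k)"
    by (simp_all add: omega_cis complex_nonpos_Reals_iff)
  from im have "cos (phi A k) = 1 \<or> cos (phi A k) = - 1"
    using sin_cos_squared_add[of "phi A k"] by (simp add: power2_eq_1_iff)
  with re assms(3) have "cos (phi A k) = 1" by auto
  with im have "omega A k = 1" by (simp add: omega_cis complex_eq_iff)
  with omega_neq_1 assms(1,2) show False by blast
qed

text \<open>With \<open>z = u - omega A k\<close> and \<theta> = \<open>B * phi A k\<close>, this is
  the real part of \<open>cis\<close> \<theta> times
  \<open>ln (cmod z) + \<i> * Arg z\<close>.\<close>

lemma Re_summand:
  assumes "u \<in> {0..<1}"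
  shows "Re (omega A k ^ B * Ln (complex_of_real u - omega A k)) = C A B k u + S A B k u"
proof -
  define z where "z = complex_of_real u - omega A k"
  have z: "z = Complex (u - cos (phi A k)) (- sin (phi A k))"
    by (simp add: z_def omega_cis complex_eq_iff)
  have nz: "z \<noteq> 0"
    using diff_omega_nonzero[OF assms] by (simp add: z_def)
  \<comment> \<open>Law of cosines for the points \<open>u\<close> and \<open>omega A k\<close>. The
    square of the modulus accounts for the factor 1/2 in \<open>C\<close>.\<close>
  have "(cmod z)\<^sup>2 = u\<^sup>2 + 1 - 2 * u * cos (phi A k)"
    using sin_cos_squared_add[of "phi A k"]
    by (simp add: z cmod_power2 power2_diff)
  then have "ln (u\<^sup>2 + 1 - 2 * u * cos (phi A k)) = 2 * ln (cmod z)"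
    using nz by (metis ln_realpow norm_eq_zero of_nat_numeral zero_less_norm_iff)
  moreover have "atan2 (- sin (phi A k)) (u - cos (phi A k)) = Im (Ln z)"
    using nz by (simp add: atan2_def Arg_eq_Im_Ln flip: z)
  moreover have "omega A k ^ B = cis (real B * phi A k)"
    by (simp add: omega_cis Complex.DeMoivre)
  ultimately show ?thesis
    using nz by (simp add: C_def S_def flip: z_def)
qed

text \<open>Off the branch cut the principal logarithm commutes with conjugation, and reflecting the
  index conjugates the root.\<close>

lemma summand_reflect:
  assumes "0 < k" "k < A" "0 \<le> u"
  shows "omega A (A - k) ^ B * Ln (complex_of_real u - omega A (A - k)) =
    cnj (omega A k ^ B * Ln (complex_of_real u - omega A k))"
  using cnj_Ln[OF diff_omega_off_branch_cut[OF assms]] assms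
  by (simp add: omega_reflect)

lemma sum_Im_summands:
  assumes "0 < A" "u \<in> {0..<1}"
  shows "(\<Sum>k = 0..A - 1. Im (omega A k ^ B * Ln (complex_of_real u - omega A k))) = pi"
proof -
  define f where "f k = Im (omega A k ^ B * Ln (complex_of_real u - omega A k))" for k
  have "f (A - k) = - f k" if "k \<in> {1..<A}" for k
    using summand_reflect[of k A u B] that assms unfolding f_def by (simp del: times_complex.sel complex_cnj_mult)
  \<comment> \<open>The reflection permutes the nonzero indices, so their sum equals its own
    negative. For even \<open>A\<close> the fixed index \<open>A / 2\<close> is covered too, since
    there \<open>f\<close> is its own negative.\<close>
  moreover have "(\<Sum>k\<in>{1..<A}. f k) = (\<Sum>k\<in>{1..<A}. f (A - k))"
    by (rule sum.reindex_bij_witness[of _ "\<lambda>k. A - k" "\<lambda>k. A - k"]) auto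
  ultimately have "(\<Sum>k\<in>{1..<A}. f k) = 0"
    by (simp add: sum_negf)
  moreover have "{0..A - 1} = insert 0 {1..<A}"
    using assms(1) by auto
  moreover have "f 0 = pi"
  proof -
    \<comment> \<open>\<open>u - 1\<close> is a negative real, and the principal branch takes the
      value from above the cut; the factor \<open>omega A 0 ^ B\<close> is 1.\<close>
    have "Im (Ln (complex_of_real (u - 1))) = pi"
      using assms(2) by (subst Im_Ln_eq_pi) auto
    then show ?thesis by (simp add: f_def omega_def)
  qed
  ultimately show ?thesis
    unfolding f_def[symmetric] by simp
qed

theorem lemma2:
  fixes A B :: nat and u :: real
  assumes "A > 0" and "B > 0" and "coprime A B"
    and "u \<in> {0..<1}"
  shows "L A B u =
    complex_of_real (- (real B / real A) * (\<Sum>k = 0..A - 1. C A B k u + S A B k u))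
      - \<i> * complex_of_real (pi * real B / real A)"
proof -
  have "L A B u = complex_of_real (- (real B / real A)) *
      (\<Sum>k = 0..A - 1. omega A k ^ B * Ln (complex_of_real u - omega A k))"
    by (simp add: L_def)
  also have "(\<Sum>k = 0..A - 1. omega A k ^ B * Ln (complex_of_real u - omega A k)) =
      Complex (\<Sum>k = 0..A - 1. C A B k u + S A B k u) pi"
    using sum_Im_summands[OF assms(1,4)] Re_summand[OF assms(4)]
    by (simp add: complex_eq_iff del: times_complex.sel)
  finally show ?thesis
    by (simp add: complex_eq_iff)
qed

end
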